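(* Let $n\geq 1$, let $(m_{i,j})_{0\le i\le n+1,\ j\in\mathbb{Z}}$ be a frieze pattern of height $n$, and choose a lightning bolt in it, i.e. integers $j_1,\dotsc,j_n$ with $j_{i+1}\in\{j_i,\,j_i-1\}$ for $1\le i\le n-1$, with entries $v_i=m_{i,j_i}$ for $1\leq i\leq n$. Then there is an orientation $Q$ of the Dynkin diagram $\mathsf{A}_n$ such that every entry $m_{i,j}$ of the frieze in a non-trivial row (that is, with $1\le i\le n$ and $j\in\mathbb{Z}$) is obtained by taking a cluster variable of the cluster algebra $\mathscr{A}_Q$ and specialising the indeterminates $x_1,\dotsc,x_n$ to the values of the frieze in the lightning bolt, $x_k\mapsto v_k$ for $k=1,\dotsc,n$.
   Context: **Frieze patterns.** A frieze pattern of height $n$ consists of $n+2$ rows, each infinite in both directions, of positive integers, written with consecutive rows offset from one another by half a step. Index the rows from top to bottom by $0,1,\dotsc,n+1$, and write $m_{i,j}$ ($j\in\mathbb{Z}$) for the entries of row $i$ from left to right, where $m_{i,j}$ is drawn at horizontal position $2j+i$. The defining properties are: (a) every entry in the first and last rows is $1$, i.e. $m_{0,j}=m_{n+1,j}=1$ for all $j$; (b) the $\mathrm{SL}_2$ diamond rule: in each local diamond with left entry $a$, top entry $b$, bottom entry $c$ and right entry $d$ one has $ad-bc=1$; in coordinates, $m_{i,j}\,m_{i,j+1}-m_{i-1,j+1}\,m_{i+1,j}=1$ for all $1\le i\le n$ and $j\in\mathbb{Z}$. Rows $0$ and $n+1$ are called trivial; rows $1,\dotsc,n$ are called non-trivial.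 **Lightning bolts.** A lightning bolt is a choice of one entry in each non-trivial row such that the chosen entries in each pair of adjacent rows form part of the same diamond (i.e. they are diagonal neighbours, at horizontal distance one). In the coordinates above this means choosing $m_{i,j_i}$ for $1\le i\le n$ with $j_{i+1}\in\{j_i,\,j_i-1\}$ for all $1\le i\le n-1$. **Quivers.** A quiver $Q$ is a directed graph with vertex set $Q_0=\{1,\dotsc,n\}$ and a finite set $Q_1$ of arrows (multiple arrows allowed). A cluster quiver is a quiver with no oriented cycles of length $1$ (loops) or $2$ ($2$-cycles). The mutation $\mu_kQ$ of a cluster quiver $Q$ at a vertex $k$ is obtained by: (1) for each length $2$ path $i\to k\to j$, adding an arrow $i\to j$; (2) reversing all arrows incident with $k$; (3) choosing a maximal set of $2$-cycles, and removing all arrows appearing in them. An orientation of the Dynkin diagram $\mathsf{A}_n$ is a quiver with vertices $1,\dotsc,n$, having exactly one arrow (in one of the two directions) between $i$ and $i+1$ for each $1\le i\le n-1$, and no other arrows. **Cluster algebras (no frozen variables).** A seed consists of a cluster quiver $Q$ with vertex set $\{1,\dotsc,n\}$ and a free generating set $\{f_1,\dotsc,f_n\}$ of the field $\mathbb{Q}(x_1,\dotsc,x_n)$, indexed by the vertices; being a free generating set means that the smallest subfield containing $\mathbb{Q}$ and $f_1,\dotsc,f_n$ is $\mathbb{Q}(x_1,\dotsc,x_n)$ itself. Mutation of seeds at a vertex $k$ is defined by $\mu_k(Q,\{f_i\})=(\mu_kQ,\{f_i'\})$ with $f_i'=f_i$ for $i\neq k$ and $$f_k'=\frac{1}{f_k}\Big(\prod_{k\to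 j}f_j+\prod_{\ell\to k}f_\ell\Big),$$ where the products are over the arrows of $Q$ with tail $k$, respectively head $k$, and empty products equal $1$. Given a cluster quiver $Q$, let $\mathcal{S}_Q$ be the set of all seeds obtained from the initial seed $(Q,\{x_1,\dotsc,x_n\})$ by finite sequences of mutations. The cluster algebra $\mathscr{A}_Q$ is the $\mathbb{Q}$-subalgebra of $\mathbb{Q}(x_1,\dotsc,x_n)$ generated by all functions appearing in all seeds in $\mathcal{S}_Q$; each such function is called a cluster variable of $\mathscr{A}_Q$. **Specialisation.** By the known Laurent phenomenon (Fomin--Zelevinsky), every cluster variable of $\mathscr{A}_Q$ is a Laurent polynomial in $x_1,\dotsc,x_n$, so it can be evaluated at any point with non-zero coordinates, in particular at $(v_1,\dotsc,v_n)$. *)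

theory Defs
  imports Complex_Main "HOL-Library.Multiset" "HOL-Library.Poly_Mapping"
    "HOL-Computational_Algebra.Fraction_Field"
begin

section \<open>Frieze patterns\<close>

text \<open>
  Entry \<open>m i j\<close> is the \<open>j\<close>-th entry of row \<open>i\<close>, drawn at horizontal position \<open>2 j + i\<close>. Only the
  rows \<open>0, \<dots>, n + 1\<close> are part of the pattern; the values of \<open>m\<close> on other rows are irrelevant.
\<close>

definition frieze_pattern :: "nat \<Rightarrow> (nat \<Rightarrow> int \<Rightarrow> int) \<Rightarrow> bool" where
  "frieze_pattern n m \<longleftrightarrow>
     (\<forall>i\<in>{0..n+1}. \<forall>j. m i j > 0) \<and>
     (\<forall>j. m 0 j = 1 \<and> m (n+1) j = 1) \<and>
     (\<forall>i\<in>{1..n}. \<forall>j. m i j * m i (j+1) - m (i-1) (j+1) * m (i+1) j = 1)"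

text \<open>A lightning bolt is given by the positions \<open>b 1, \<dots>, b n\<close> of its entries in their rows.\<close>

definition lightning_bolt :: "nat \<Rightarrow> (nat \<Rightarrow> int) \<Rightarrow> bool" where
  "lightning_bolt n b \<longleftrightarrow> (\<forall>i\<in>{1..<n}. b (i+1) \<in> {b i, b i - 1})"

section \<open>Quivers\<close>

text \<open>
  A quiver with vertex set \<open>{1..n}\<close> is given by its finite multiset of arrows; \<open>(i, j)\<close> is an arrow
  with tail \<open>i\<close> and head \<open>j\<close>.
\<close>

type_synonym quiver = "(nat \<times> nat) multiset"

definition quiver :: "nat \<Rightarrow> quiver \<Rightarrow> bool" where
  "quiver n Q \<longleftrightarrow> set_mset Q \<subseteq> {1..n} \<times> {1..n}"

definition cluster_quiver :: "nat \<Rightarrow> quiver \<Rightarrow> bool" where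
  "cluster_quiver n Q \<longleftrightarrow> quiver n Q \<and>
     (\<forall>i. (i, i) \<notin># Q) \<and> (\<forall>i j. \<not> ((i, j) \<in># Q \<and> (j, i) \<in># Q))"

definition A_orientation :: "nat \<Rightarrow> quiver \<Rightarrow> bool" where
  "A_orientation n Q \<longleftrightarrow> quiver n Q \<and>
     (\<forall>i\<in>{1..<n}. count Q (i, i+1) + count Q (i+1, i) = 1) \<and>
     (\<forall>(i, j)\<in>set_mset Q. j = i + 1 \<or> i = j + 1)"

definition add_composites :: "nat \<Rightarrow> quiver \<Rightarrow> quiver" where
  "add_composites k Q =
     Q + (\<Sum>a\<in>#{#a \<in># Q. snd a = k#}. {#(fst a, snd b). b \<in># {#b \<in># Q. fst b = k#}#})"

definition reverse_at :: "nat \<Rightarrow> quiver \<Rightarrow> quiver" where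
  "reverse_at k Q = image_mset (\<lambda>(i, j). if i = k \<or> j = k then (j, i) else (i, j)) Q"

text \<open>
  In a quiver without loops, the 2-cycles of a maximal family of pairwise disjoint 2-cycles between
  \<open>i\<close> and \<open>j\<close> number \<open>min (count Q (i, j)) (count Q (j, i))\<close>, and each uses one arrow in
  either direction.
\<close>

definition cancel_2cycles :: "quiver \<Rightarrow> quiver" where
  "cancel_2cycles Q = Q - (Q \<inter># image_mset prod.swap Q)"

definition mutate_quiver :: "nat \<Rightarrow> quiver \<Rightarrow> quiver" where
  "mutate_quiver k Q = cancel_2cycles (reverse_at k (add_composites k Q))"

section \<open>Rational functions\<close>

text \<open>
  Polynomials over \<open>\<rat>\<close> in the variables \<open>x\<^sub>0, x\<^sub>1, \<dots>\<close>: a monomial is its finitely supported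
  exponent vector, a polynomial its finitely supported family of coefficients. The field
  \<open>\<rat>(x\<^sub>1, \<dots>, x\<^sub>n)\<close> is realised inside the fraction field.
\<close>

type_synonym polynomial = "(nat \<Rightarrow>\<^sub>0 nat) \<Rightarrow>\<^sub>0 rat"
type_synonym ratfun = "polynomial fract"

definition indet :: "nat \<Rightarrow> ratfun" where
  "indet i = Fract (Poly_Mapping.single (Poly_Mapping.single i 1) 1) 1"

text \<open>Subfields automatically contain the prime field \<open>\<rat>\<close>.\<close>

definition is_subfield :: "'a::field set \<Rightarrow> bool" where
  "is_subfield K \<longleftrightarrow> 0 \<in> K \<and> 1 \<in> K \<and>
     (\<forall>a\<in>K. \<forall>b\<in>K. a + b \<in> K \<and> a * b \<in> K) \<and> (\<forall>a\<in>K. - a \<in> K \<and> inverse a \<in> K)"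

definition field_generated :: "'a::field set \<Rightarrow> 'a set" where
  "field_generated S = \<Inter> {K. is_subfield K \<and> S \<subseteq> K}"

definition ratfun_field :: "nat \<Rightarrow> ratfun set" where
  "ratfun_field n = field_generated (indet ` {1..n})"

subsection \<open>Specialisation of Laurent polynomials\<close>

definition monom_eval :: "(nat \<Rightarrow> rat) \<Rightarrow> (nat \<Rightarrow>\<^sub>0 nat) \<Rightarrow> rat" where
  "monom_eval v d = (\<Prod>i\<in>Poly_Mapping.keys d. v i ^ Poly_Mapping.lookup d i)"

definition poly_eval :: "(nat \<Rightarrow> rat) \<Rightarrow> polynomial \<Rightarrow> rat" where
  "poly_eval v p = (\<Sum>d\<in>Poly_Mapping.keys p. Poly_Mapping.lookup p d * monom_eval v d)"

definition poly_vars :: "polynomial \<Rightarrow> nat set" where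
  "poly_vars p = (\<Union>d\<in>Poly_Mapping.keys p. Poly_Mapping.keys d)"

text \<open>
  \<open>specialises n v f c\<close>: the rational function \<open>f\<close> is a Laurent polynomial in \<open>x\<^sub>1, \<dots>, x\<^sub>n\<close>, that is
  \<open>f = p / x^d\<close> for a polynomial \<open>p\<close> and a monomial \<open>x^d\<close> in these variables, and its value at
  \<open>(v 1, \<dots>, v n)\<close>, a point with non-zero coordinates, is \<open>c\<close>. The value does not depend on the
  choice of \<open>p\<close> and \<open>d\<close>, see lemma \<open>specialises_unique\<close>.
\<close>

definition specialises :: "nat \<Rightarrow> (nat \<Rightarrow> rat) \<Rightarrow> ratfun \<Rightarrow> rat \<Rightarrow> bool" where
  "specialises n v f c \<longleftrightarrow> (\<forall>k\<in>{1..n}. v k \<noteq> 0) \<and>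
     (\<exists>p d. poly_vars p \<subseteq> {1..n} \<and> Poly_Mapping.keys d \<subseteq> {1..n} \<and>
        f = Fract p (Poly_Mapping.single d 1) \<and> c = poly_eval v p / monom_eval v d)"

section \<open>Cluster algebras\<close>

text \<open>
  In a pair \<open>(Q, f)\<close> the function \<open>f k\<close> is attached to the vertex \<open>k \<in> {1..n}\<close>; values of \<open>f\<close>
  outside \<open>{1..n}\<close> are irrelevant. As \<open>\<rat>(x\<^sub>1, \<dots>, x\<^sub>n)\<close> has transcendence degree \<open>n\<close>, generators
  \<open>f 1, \<dots>, f n\<close> of it are automatically algebraically independent.
\<close>

definition seed :: "nat \<Rightarrow> quiver \<times> (nat \<Rightarrow> ratfun) \<Rightarrow> bool" where
  "seed n = (\<lambda>(Q, f). cluster_quiver n Q \<and> field_generated (f ` {1..n}) = ratfun_field n)"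

definition mutate_seed ::
    "nat \<Rightarrow> quiver \<times> (nat \<Rightarrow> ratfun) \<Rightarrow> quiver \<times> (nat \<Rightarrow> ratfun)" where
  "mutate_seed k = (\<lambda>(Q, f). (mutate_quiver k Q,
     f(k := 1 / f k *
         ((\<Prod>a\<in>#{#a \<in># Q. fst a = k#}. f (snd a)) + (\<Prod>a\<in>#{#a \<in># Q. snd a = k#}. f (fst a))))))"

inductive_set seeds :: "nat \<Rightarrow> quiver \<Rightarrow> (quiver \<times> (nat \<Rightarrow> ratfun)) set" for n Q where
  initial: "(Q, indet) \<in> seeds n Q"
| mutate: "s \<in> seeds n Q \<Longrightarrow> k \<in> {1..n} \<Longrightarrow> mutate_seed k s \<in> seeds n Q"

definition cluster_variables :: "nat \<Rightarrow> quiver \<Rightarrow> ratfun set" where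
  "cluster_variables n Q = (\<Union>(R, f)\<in>seeds n Q. f ` {1..n})"

definition is_subalgebra :: "ratfun set \<Rightarrow> bool" where
  "is_subalgebra A \<longleftrightarrow> (\<forall>q. Fract (Poly_Mapping.single 0 q) 1 \<in> A) \<and>
     (\<forall>a\<in>A. \<forall>b\<in>A. a + b \<in> A \<and> a * b \<in> A)"

definition cluster_algebra :: "nat \<Rightarrow> quiver \<Rightarrow> ratfun set" where
  "cluster_algebra n Q = \<Inter> {A. is_subalgebra A \<and> cluster_variables n Q \<subseteq> A}"

section \<open>Consistency of the definitions\<close>

subsection \<open>Evaluation is a ring homomorphism\<close>

lemma monom_eval_superset:
  assumes "finite A" "Poly_Mapping.keys d \<subseteq> A"
  shows "monom_eval v d = (\<Prod>i\<in>A. v i ^ Poly_Mapping.lookup d i)"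
  unfolding monom_eval_def using assms
  by (intro prod.mono_neutral_left) (auto simp: in_keys_iff)

lemma monom_eval_add: "monom_eval v (d + e) = monom_eval v d * monom_eval v e"
proof -
  let ?A = "Poly_Mapping.keys d \<union> Poly_Mapping.keys e"
  have "Poly_Mapping.keys (d + e) \<subseteq> ?A" by (rule keys_add)
  then show ?thesis
    by (simp add: monom_eval_superset[of ?A] lookup_add power_add prod.distrib)
qed

lemma monom_eval_zero [simp]: "monom_eval v 0 = 1"
  by (simp add: monom_eval_def)

lemma poly_eval_superset:
  assumes "finite A" "Poly_Mapping.keys p \<subseteq> A"
  shows "poly_eval v p = (\<Sum>d\<in>A. Poly_Mapping.lookup p d * monom_eval v d)"
  unfolding poly_eval_def using assms
  by (intro sum.mono_neutral_left) (auto simp: in_keys_iff)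

lemma poly_eval_zero [simp]: "poly_eval v 0 = 0"
  by (simp add: poly_eval_def)

lemma poly_eval_add: "poly_eval v (p + q) = poly_eval v p + poly_eval v q"
proof -
  let ?A = "Poly_Mapping.keys p \<union> Poly_Mapping.keys q"
  have "Poly_Mapping.keys (p + q) \<subseteq> ?A" by (rule keys_add)
  then show ?thesis
    by (simp add: poly_eval_superset[of ?A] lookup_add sum.distrib algebra_simps)
qed

lemma poly_eval_sum: "poly_eval v (\<Sum>i\<in>A. f i) = (\<Sum>i\<in>A. poly_eval v (f i))"
  by (induction A rule: infinite_finite_induct) (simp_all add: poly_eval_add)

lemma poly_eval_single: "poly_eval v (Poly_Mapping.single d c) = c * monom_eval v d"
  by (simp add: poly_eval_def)

lemma poly_eval_one [simp]: "poly_eval v 1 = 1"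
  using poly_eval_single[of v 0 1] by simp

lemma polynomial_expand:
  fixes p :: polynomial
  shows "p = (\<Sum>d\<in>Poly_Mapping.keys p. Poly_Mapping.single d (Poly_Mapping.lookup p d))"
proof (rule poly_mapping_eqI)
  fix k
  have "Poly_Mapping.lookup (\<Sum>d\<in>Poly_Mapping.keys p. Poly_Mapping.single d (Poly_Mapping.lookup p d)) k
      = (\<Sum>d\<in>Poly_Mapping.keys p. if d = k then Poly_Mapping.lookup p d else 0)"
    by (simp add: lookup_sum lookup_single when_def)
  also have "\<dots> = Poly_Mapping.lookup p k"
    by (simp add: in_keys_iff)
  finally show "Poly_Mapping.lookup p k = Poly_Mapping.lookup
      (\<Sum>d\<in>Poly_Mapping.keys p. Poly_Mapping.single d (Poly_Mapping.lookup p d)) k" by simp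
qed

lemma poly_eval_mult: "poly_eval v (p * q) = poly_eval v p * poly_eval v q"
proof -
  let ?P = "Poly_Mapping.keys p" and ?Q = "Poly_Mapping.keys q"
  let ?p = "Poly_Mapping.lookup p" and ?q = "Poly_Mapping.lookup q"
  have "p * q = (\<Sum>d\<in>?P. Poly_Mapping.single d (?p d)) * (\<Sum>e\<in>?Q. Poly_Mapping.single e (?q e))"
    using polynomial_expand[of p] polynomial_expand[of q] by simp
  also have "\<dots> = (\<Sum>d\<in>?P. \<Sum>e\<in>?Q. Poly_Mapping.single (d + e) (?p d * ?q e))"
    by (simp add: sum_product mult_single)
  finally have "poly_eval v (p * q) = (\<Sum>d\<in>?P. \<Sum>e\<in>?Q. ?p d * ?q e * monom_eval v (d + e))"
    by (simp add: poly_eval_sum poly_eval_single)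
  also have "\<dots> = poly_eval v p * poly_eval v q"
    by (simp add: poly_eval_def sum_product monom_eval_add algebra_simps)
  finally show ?thesis .
qed

lemma specialises_unique:
  assumes "specialises n v f c" "specialises n v f c'"
  shows "c = c'"
proof -
  obtain p d where 1: "Poly_Mapping.keys d \<subseteq> {1..n}"
      "f = Fract p (Poly_Mapping.single d 1)" "c = poly_eval v p / monom_eval v d"
    using assms(1) unfolding specialises_def by blast
  obtain q e where 2: "Poly_Mapping.keys e \<subseteq> {1..n}"
      "f = Fract q (Poly_Mapping.single e 1)" "c' = poly_eval v q / monom_eval v e"
    using assms(2) unfolding specialises_def by blast
  have v: "\<forall>k\<in>{1..n}. v k \<noteq> 0" using assms(1) by (simp add: specialises_def)
  have nz: "Poly_Mapping.single d (1::rat) \<noteq> 0" for d :: "nat \<Rightarrow>\<^sub>0 nat"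
    by (metis lookup_single_eq lookup_zero zero_neq_one)
  have "p * Poly_Mapping.single e 1 = q * Poly_Mapping.single d 1"
    using 1(2) 2(2) nz by (simp add: eq_fract)
  then have "poly_eval v (p * Poly_Mapping.single e 1) = poly_eval v (q * Poly_Mapping.single d 1)"
    by simp
  then have "poly_eval v p * monom_eval v e = poly_eval v q * monom_eval v d"
    by (simp add: poly_eval_mult poly_eval_single)
  moreover have "monom_eval v d \<noteq> 0" "monom_eval v e \<noteq> 0"
    using v 1(1) 2(1) by (auto simp: monom_eval_def)
  ultimately show ?thesis using 1(3) 2(3) by (simp add: frac_eq_eq)
qed

subsection \<open>Mutation yields seeds\<close>

lemma cluster_quiver_orientation:
  assumes "A_orientation n Q"
  shows "cluster_quiver n Q"
proof -
  have q: "quiver n Q" and c: "\<And>i. i \<in> {1..<n} \<Longrightarrow> count Q (i, i+1) + count Q (i+1, i) = 1"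
    and a: "\<And>i j. (i, j) \<in># Q \<Longrightarrow> j = i + 1 \<or> i = j + 1"
    using assms unfolding A_orientation_def by auto
  have no: False if "(i, i+1) \<in># Q" "(i+1, i) \<in># Q" for i
  proof -
    have "i \<in> {1..<n}" using that q by (auto simp: quiver_def)
    from c[OF this] that show False
      by (metis One_nat_def add_is_1 not_in_iff)
  qed
  show ?thesis unfolding cluster_quiver_def
    using q a no by force
qed

lemma in_add_composites:
  "(i, j) \<in># add_composites k Q \<longleftrightarrow> (i, j) \<in># Q \<or> ((i, k) \<in># Q \<and> (k, j) \<in># Q)"
proof -
  have eq: "set_mset (add_composites k Q) = set_mset Q \<union>
      (\<Union>a\<in>{a \<in> set_mset Q. snd a = k}. (\<lambda>b. (fst a, snd b)) ` {b \<in> set_mset Q. fst b = k})"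
    by (simp add: add_composites_def conj_commute)
  show ?thesis
  proof
    assume "(i, j) \<in># add_composites k Q"
    then consider "(i, j) \<in># Q" | a b where "a \<in># Q" "snd a = k" "b \<in># Q" "fst b = k"
        "i = fst a" "j = snd b"
      unfolding eq by blast
    then show "(i, j) \<in># Q \<or> ((i, k) \<in># Q \<and> (k, j) \<in># Q)"
      by cases auto
  next
    assume "(i, j) \<in># Q \<or> ((i, k) \<in># Q \<and> (k, j) \<in># Q)"
    then show "(i, j) \<in># add_composites k Q"
    proof
      assume "(i, k) \<in># Q \<and> (k, j) \<in># Q"
      then have "(i, k) \<in> {a \<in> set_mset Q. snd a = k}"
          "(i, j) \<in> (\<lambda>b. (fst (i, k), snd b)) ` {b \<in> set_mset Q. fst b = k}"
        by (simp, intro image_eqI[of _ _ "(k, j)"], simp_all)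
      then show ?thesis unfolding eq by blast
    qed (simp add: eq)
  qed
qed

lemma in_reverse_at:
  "(i, j) \<in># reverse_at k Q \<longleftrightarrow> (if i = k \<or> j = k then (j, i) \<in># Q else (i, j) \<in># Q)"
proof -
  let ?g = "\<lambda>(i, j). if i = k \<or> j = k then (j, i) else (i, j)"
  have g: "?g (?g a) = a" for a by (cases a) simp
  have "(i, j) \<in> ?g ` set_mset Q \<longleftrightarrow> ?g (i, j) \<in> set_mset Q"
    using g by (metis (no_types, lifting) imageE image_eqI)
  then show ?thesis by (simp add: reverse_at_def)
qed

lemma count_swap: "count (image_mset prod.swap Q) (i, j) = count Q (j, i)"
proof -
  have "prod.swap -` {(i, j)} \<inter> set_mset Q = (if (j, i) \<in># Q then {(j, i)} else {})"
    by (auto simp: prod.swap_def)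
  then show ?thesis
    by (simp add: count_image_mset not_in_iff)
qed

lemma count_cancel_2cycles:
  "count (cancel_2cycles Q) (i, j) = count Q (i, j) - count Q (j, i)"
  by (simp add: cancel_2cycles_def count_swap)

lemma cluster_quiver_mutate:
  assumes "cluster_quiver n Q" "k \<in> {1..n}"
  shows "cluster_quiver n (mutate_quiver k Q)"
proof -
  let ?R = "reverse_at k (add_composites k Q)"
  have sub: "(i, j) \<in># ?R" "count ?R (i, j) > count ?R (j, i)" if "(i, j) \<in># mutate_quiver k Q" for i j
  proof -
    have "0 < count (mutate_quiver k Q) (i, j)"
      using that by simp
    then show "count ?R (i, j) > count ?R (j, i)"
      by (simp add: mutate_quiver_def count_cancel_2cycles)
    then show "(i, j) \<in># ?R" by (metis count_greater_zero_iff gr_implies_not0 neq0_conv)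
  qed
  have "set_mset ?R \<subseteq> {1..n} \<times> {1..n}"
  proof
    fix a assume "a \<in># ?R"
    then show "a \<in> {1..n} \<times> {1..n}"
      using assms by (cases a) (auto simp: in_reverse_at in_add_composites cluster_quiver_def
          quiver_def split: if_splits)
  qed
  then have "quiver n (mutate_quiver k Q)"
    unfolding quiver_def using sub(1) by auto
  then show ?thesis
    unfolding cluster_quiver_def using sub(2) by (meson less_asym less_irrefl)
qed

text \<open>A sufficient criterion for a rational function to be non-zero.\<close>

definition positive_at_one :: "ratfun \<Rightarrow> bool" where
  "positive_at_one f \<longleftrightarrow> (\<exists>p q. f = Fract p q \<and> poly_eval (\<lambda>_. 1) p > 0 \<and> poly_eval (\<lambda>_. 1) q > 0)"

lemma positive_at_one_nonzero: "positive_at_one f \<Longrightarrow> f \<noteq> 0"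
proof
  assume "positive_at_one f" "f = 0"
  then obtain p q where *: "Fract p q = 0" "poly_eval (\<lambda>_. 1) p > 0" "poly_eval (\<lambda>_. 1) q > 0"
    by (auto simp: positive_at_one_def)
  then have "q \<noteq> 0" by auto
  with *(1) have "p = 0" by (simp add: Zero_fract_def eq_fract)
  with *(2) show False by simp
qed

lemma positive_at_one_add:
  assumes "positive_at_one f" "positive_at_one g" shows "positive_at_one (f + g)"
proof -
  obtain p q where 1: "f = Fract p q" "poly_eval (\<lambda>_. 1) p > 0" "poly_eval (\<lambda>_. 1) q > 0"
    using assms(1) by (auto simp: positive_at_one_def)
  obtain r s where 2: "g = Fract r s" "poly_eval (\<lambda>_. 1) r > 0" "poly_eval (\<lambda>_. 1) s > 0"
    using assms(2) by (auto simp: positive_at_one_def)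
  have "q \<noteq> 0" "s \<noteq> 0" using 1 2 by auto
  then have "f + g = Fract (p * s + r * q) (q * s)" using 1 2 by simp
  then show ?thesis unfolding positive_at_one_def using 1 2
    by (intro exI[of _ "p * s + r * q"] exI[of _ "q * s"])
      (simp add: poly_eval_add poly_eval_mult add_pos_pos)
qed

lemma positive_at_one_mult:
  assumes "positive_at_one f" "positive_at_one g" shows "positive_at_one (f * g)"
proof -
  obtain p q where 1: "f = Fract p q" "poly_eval (\<lambda>_. 1) p > 0" "poly_eval (\<lambda>_. 1) q > 0"
    using assms(1) by (auto simp: positive_at_one_def)
  obtain r s where 2: "g = Fract r s" "poly_eval (\<lambda>_. 1) r > 0" "poly_eval (\<lambda>_. 1) s > 0"
    using assms(2) by (auto simp: positive_at_one_def)
  have "f * g = Fract (p * r) (q * s)" using 1 2 by simp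
  then show ?thesis unfolding positive_at_one_def using 1 2
    by (intro exI[of _ "p * r"] exI[of _ "q * s"]) (simp add: poly_eval_mult)
qed

lemma positive_at_one_inverse:
  assumes "positive_at_one f" shows "positive_at_one (inverse f)"
  using assms unfolding positive_at_one_def by (metis inverse_fract)

lemma positive_at_one_1: "positive_at_one 1"
  unfolding positive_at_one_def One_fract_def by (intro exI[of _ 1]) simp

lemma positive_at_one_prod_mset:
  "(\<And>a. a \<in># M \<Longrightarrow> positive_at_one (g a)) \<Longrightarrow> positive_at_one (\<Prod>a\<in>#M. g a)"
  by (induction M) (simp_all add: positive_at_one_1 positive_at_one_mult)

lemma positive_at_one_indet: "positive_at_one (indet i)"
  unfolding positive_at_one_def indet_def
  by (intro exI[of _ "Poly_Mapping.single (Poly_Mapping.single i 1) 1"] exI[of _ 1])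
    (simp add: poly_eval_single monom_eval_def)

lemma subfield_field_generated: "is_subfield (field_generated S)"
  by (simp add: is_subfield_def field_generated_def)

lemma field_generated_superset: "S \<subseteq> field_generated S"
  by (auto simp: field_generated_def)

lemma field_generated_least: "is_subfield K \<Longrightarrow> S \<subseteq> K \<Longrightarrow> field_generated S \<subseteq> K"
  by (auto simp: field_generated_def)

lemma subfield_prod_mset:
  "is_subfield K \<Longrightarrow> (\<And>a. a \<in># M \<Longrightarrow> g a \<in> K) \<Longrightarrow> (\<Prod>a\<in>#M. g a) \<in> K"
  by (induction M) (simp_all add: is_subfield_def)

lemma subfield_exchange:
  fixes g h P :: "'a::field"
  assumes "is_subfield K" "P \<in> K" "h \<in> K" "g * h = P" "h \<noteq> 0"
  shows "g \<in> K"
proof -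
  have "g = P * inverse h" using assms by (auto simp: field_simps)
  then show ?thesis using assms(1-3) unfolding is_subfield_def by blast
qed

lemma field_generated_insert_exchange:
  fixes g h P :: "'a::field"
  assumes "P \<in> field_generated S" "g * h = P" "h \<noteq> 0"
  shows "field_generated (insert g S) \<subseteq> field_generated (insert h S)"
proof -
  let ?K = "field_generated (insert h S)"
  have K: "is_subfield ?K" "insert h S \<subseteq> ?K"
    by (rule subfield_field_generated field_generated_superset)+
  then have "P \<in> ?K" using assms(1) field_generated_least[of ?K S] by blast
  with K assms have "g \<in> ?K" using subfield_exchange[of ?K P h g] by blast
  with K show ?thesis by (intro field_generated_least) auto
qed

lemma field_generated_exchange:
  fixes f :: "'i \<Rightarrow> 'a::field"
  assumes k: "k \<in> I" and P: "P \<in> field_generated (f ` (I - {k}))"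
    and g: "g * f k = P" and nz: "f k \<noteq> 0" "P \<noteq> 0"
  shows "field_generated ((f(k := g)) ` I) = field_generated (f ` I)"
proof -
  have img: "f ` I = insert (f k) (f ` (I - {k}))" "(f(k := g)) ` I = insert g (f ` (I - {k}))"
    using k by (auto simp: image_iff)
  have "f k * g = P" "g \<noteq> 0" using g nz by (auto simp: mult.commute)
  then show ?thesis
    unfolding img using field_generated_insert_exchange[OF P] g nz by blast
qed

lemma seeds_are_seeds:
  assumes "cluster_quiver n Q" "s \<in> seeds n Q"
  shows "seed n s"
proof -
  have "seed n s \<and> (\<forall>i. positive_at_one (snd s i))"
    using assms(2)
  proof induction
    case initial
    show ?case using assms(1) by (simp add: seed_def ratfun_field_def positive_at_one_indet)
  next
    case (mutate s k)
    obtain R f where s: "s = (R, f)" by (cases s)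
    have R: "cluster_quiver n R" and gen: "field_generated (f ` {1..n}) = ratfun_field n"
      and pos: "\<And>i. positive_at_one (f i)"
      using mutate s by (auto simp: seed_def)
    define P where "P = (\<Prod>a\<in>#{#a \<in># R. fst a = k#}. f (snd a)) + (\<Prod>a\<in>#{#a \<in># R. snd a = k#}. f (fst a))"
    have posP: "positive_at_one P"
      unfolding P_def by (intro positive_at_one_add positive_at_one_prod_mset pos)
    have ms: "mutate_seed k s = (mutate_quiver k R, f(k := 1 / f k * P))"
      by (simp add: mutate_seed_def s P_def)
    have pos': "positive_at_one (1 / f k * P)"
      using positive_at_one_mult[OF positive_at_one_inverse[OF pos] posP]
      by (simp add: divide_inverse)
    have nz: "f k \<noteq> 0" "P \<noteq> 0" using pos posP positive_at_one_nonzero by auto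
    have "P \<in> field_generated (f ` ({1..n} - {k}))"
    proof -
      let ?K = "field_generated (f ` ({1..n} - {k}))"
      have mem: "f i \<in> ?K" if "i \<in> {1..n}" "i \<noteq> k" for i
        using that field_generated_superset[of "f ` ({1..n} - {k})"] by blast
      have arr: "a \<in> {1..n} \<times> {1..n} \<and> fst a \<noteq> snd a" if "a \<in># R" for a
        using R that unfolding cluster_quiver_def quiver_def by (metis prod.collapse subsetD)
      have "(\<Prod>a\<in>#{#a \<in># R. fst a = k#}. f (snd a)) \<in> ?K"
        using arr by (intro subfield_prod_mset subfield_field_generated mem) force+
      moreover have "(\<Prod>a\<in>#{#a \<in># R. snd a = k#}. f (fst a)) \<in> ?K"
        using arr by (intro subfield_prod_mset subfield_field_generated mem) force+
      ultimately show ?thesis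
        unfolding P_def using subfield_field_generated[of "f ` ({1..n} - {k})"]
        by (simp add: is_subfield_def)
    qed
    from field_generated_exchange[OF mutate(2) this _ nz, of "1 / f k * P"] nz
    have "field_generated ((f(k := 1 / f k * P)) ` {1..n}) = ratfun_field n"
      using gen by simp
    then show ?case
      unfolding ms using cluster_quiver_mutate[OF R mutate(2)] pos pos' by (simp add: seed_def)
  qed
  then show ?thesis ..
qed

lemma cluster_variables_subset: "cluster_variables n Q \<subseteq> cluster_algebra n Q"
  by (auto simp: cluster_algebra_def)

end

theory Submission
  imports Defs
begin

text \<open>
  Orient the edge between \<open>i\<close> and \<open>i + 1\<close> so that it points from the entry of the lightning bolt
  lying further left to the one lying further right. An entry of a bolt can be exchanged for its
  right-hand neighbour in the same row, giving another bolt, exactly when it lies to the left of its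
  neighbours in the bolt, so exactly at a source \<open>k\<close> of the quiver. There the exchange relation of
  the seed, \<open>f k * f' k = 1 + (\<Prod> of the neighbours of f k)\<close>, is the diamond rule, and mutation
  only reverses the arrows at \<open>k\<close>, as does the move of the bolt. Moves to the left happen at sinks
  in the same way. Any two lightning bolts, one of which is a translate of the other, are connected
  by such moves (\<open>bolt_moves_connect\<close>), and every entry of a frieze lies in a translate of the given
  bolt. So if \<open>F\<close> is an array of rational functions that obeys the frieze rules and has the entries
  \<open>x\<^sub>1, \<dots>, x\<^sub>n\<close> in the given bolt, then every translate of the bolt is a cluster in \<open>F\<close>. As the
  entries in a bolt are non-zero, the diamond rule determines the entry to which a move leads, both
  in \<open>F\<close> and in the frieze \<open>m\<close>; hence the entries of \<open>F\<close> specialise to the entries of \<open>m\<close> in the same place (\<open>realised_bolt_move\<close>).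

  For specialisation to make sense, the entries of \<open>F\<close> have to be Laurent polynomials. The general
  Laurent phenomenon is replaced by an explicit construction of \<open>F\<close> (\<open>frieze_with_given_bolt\<close>).
  Take the determinants \<open>F i j = det (W j, W (j + i + 1))\<close> of pairs from a sequence of vectors in the
  plane with \<open>det (W p, W (p + 1)) = 1\<close> and \<open>W (p + n + 3) = - W p\<close>. The Plucker relation gives the
  diamond rule, and the antiperiodicity gives the last row of ones. The bolt prescribes the
  determinants on a sequence of nested intervals, each of which is obtained from the one before by
  adding an end point on the left or on the right. The vector at the new end point solves two linear
  equations whose determinant is the variable \<open>x\<^sub>i\<close> of the previous interval. So only the variables
  are ever inverted, and all vectors have Laurent polynomials as coordinates.
\<close>

section \<open>Friezes from vectors in the plane\<close>

definition det2 :: "'a::field \<times> 'a \<Rightarrow> 'a \<times> 'a \<Rightarrow> 'a" where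
  "det2 u w = fst u * snd w - snd u * fst w"

text \<open>
  The three-term Plucker relation for the two-rowed matrix with columns \<open>t, u, v, w\<close>; for
  \<open>det2 t u = det2 v w = 1\<close> it is the diamond rule.
\<close>

lemma det2_plucker:
  "det2 t v * det2 u w - det2 u v * det2 t w = det2 t u * det2 v w"
  by (simp add: det2_def algebra_simps)

definition is_subring :: "'a::field set \<Rightarrow> bool" where
  "is_subring S \<longleftrightarrow> 0 \<in> S \<and> 1 \<in> S \<and> (\<forall>a\<in>S. \<forall>b\<in>S. a - b \<in> S \<and> a * b \<in> S)"

text \<open>
  If \<open>det2 u w = x \<noteq> 0\<close>, then \<open>extend_vec x y u w\<close> is the vector \<open>e\<close> with \<open>det2 u e = y\<close> and \<open>det2 w e = 1\<close>,
  given by Cramer's rule. The only division is by \<open>x\<close>.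
\<close>

definition extend_vec :: "'a::field \<Rightarrow> 'a \<Rightarrow> 'a \<times> 'a \<Rightarrow> 'a \<times> 'a \<Rightarrow> 'a \<times> 'a" where
  "extend_vec x y u w = ((y * fst w - fst u) * inverse x, (y * snd w - snd u) * inverse x)"

text \<open>
  The two lemmas treat a new vector after \<open>w\<close> and one before \<open>u\<close>. The second comes from the first by
  reversing the order of all vectors, which changes the sign of every determinant and leaves the formula as it is.
\<close>

lemma det2_extend_vec_right:
  assumes "det2 u w = x" "x \<noteq> 0"
  shows "det2 u (extend_vec x y u w) = y" "det2 w (extend_vec x y u w) = 1"
proof -
  have "det2 u (extend_vec x y u w) = y * det2 u w * inverse x"
    by (simp add: det2_def extend_vec_def algebra_simps)
  then show "det2 u (extend_vec x y u w) = y" using assms by simp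
  have "det2 w (extend_vec x y u w) = det2 u w * inverse x"
    by (simp add: det2_def extend_vec_def algebra_simps)
  then show "det2 w (extend_vec x y u w) = 1" using assms by simp
qed

lemma det2_extend_vec_left:
  assumes "det2 u w = x" "x \<noteq> 0"
  shows "det2 (extend_vec x y w u) w = y" "det2 (extend_vec x y w u) u = 1"
proof -
  have "det2 (extend_vec x y w u) w = y * det2 u w * inverse x"
    by (simp add: det2_def extend_vec_def algebra_simps)
  then show "det2 (extend_vec x y w u) w = y" using assms by simp
  have "det2 (extend_vec x y w u) u = det2 u w * inverse x"
    by (simp add: det2_def extend_vec_def algebra_simps)
  then show "det2 (extend_vec x y w u) u = 1" using assms by simp
qed

text \<open>
  The entry \<open>c k\<close> of row \<open>k\<close> stands for the interval from \<open>c k\<close> to \<open>c k + k + 1\<close>. A step of the bolt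
  adds one point on the right or on the left, so that the intervals are nested.
\<close>

lemma bolt_chords_nested:
  fixes c :: "nat \<Rightarrow> int"
  assumes "\<And>k. k < N \<Longrightarrow> c (Suc k) \<in> {c k, c k - 1}" "k \<le> N"
  shows "c N \<le> c k \<and> c k + int k \<le> c N + int N"
  using assms
proof (induction N)
  case (Suc N)
  show ?case
  proof (cases "k = Suc N")
    case False
    then have "c N \<le> c k \<and> c k + int k \<le> c N + int N" using Suc by auto
    moreover have "c (Suc N) \<in> {c N, c N - 1}" using Suc.prems(1) by blast
    ultimately show ?thesis by auto
  qed simp
qed simp

text \<open>
  The vectors are chosen one at a time as the intervals of the bolt grow: the new one is fixed by
  its determinants \<open>1\<close> with the adjacent vector and \<open>x (N + 1)\<close> with the vector at the other end.
  The subring \<open>S\<close>, which contains the inverses of the \<open>x k\<close>, stands for the Laurent polynomials.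
\<close>

lemma snake_vectors:
  fixes x :: "nat \<Rightarrow> 'a::field" and c :: "nat \<Rightarrow> int"
  assumes S: "is_subring S" and x0: "x 0 = 1"
    and "\<And>k. k \<le> N \<Longrightarrow> x k \<noteq> 0 \<and> x k \<in> S \<and> inverse (x k) \<in> S"
    and "\<And>k. k < N \<Longrightarrow> c (Suc k) \<in> {c k, c k - 1}"
  shows "\<exists>w :: int \<Rightarrow> 'a \<times> 'a. range w \<subseteq> S \<times> S \<and>
    (\<forall>p. c N \<le> p \<and> p < c N + int N + 1 \<longrightarrow> det2 (w p) (w (p + 1)) = 1) \<and>
    (\<forall>k\<le>N. det2 (w (c k)) (w (c k + int k + 1)) = x k)"
  using assms(3,4)
proof (induction N)
  case 0
  let ?w = "\<lambda>p. if p = c 0 then (1, 0) else (0, 1::'a)"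
  have "range ?w \<subseteq> S \<times> S" using S by (auto simp: is_subring_def)
  then show ?case by (intro exI[of _ ?w]) (auto simp: det2_def x0)
next
  case (Suc N)
  then obtain w :: "int \<Rightarrow> 'a \<times> 'a" where wS: "range w \<subseteq> S \<times> S"
    and w1: "\<And>p. c N \<le> p \<Longrightarrow> p < c N + int N + 1 \<Longrightarrow> det2 (w p) (w (p + 1)) = 1"
    and wx: "\<And>k. k \<le> N \<Longrightarrow> det2 (w (c k)) (w (c k + int k + 1)) = x k"
    by (metis less_SucI le_SucI)
  have nest: "c N \<le> c k \<and> c k + int k \<le> c N + int N" if "k \<le> N" for k
    using bolt_chords_nested[of N c k] Suc.prems(2) that by auto
  let ?l = "c N" and ?r = "c N + int N + 1"
  have xN: "x N \<noteq> 0" "x (Suc N) \<in> S" "inverse (x N) \<in> S"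
    using Suc.prems(1) by auto
  have in_S: "extend_vec (x N) (x (Suc N)) (w p) (w q) \<in> S \<times> S" for p q
  proof -
    have "w p \<in> S \<times> S" "w q \<in> S \<times> S" using wS by auto
    then show ?thesis using S xN by (simp add: extend_vec_def is_subring_def mem_Times_iff)
  qed
  have d: "det2 (w ?l) (w ?r) = x N" using wx[of N] by simp
  consider "c (Suc N) = c N" | "c (Suc N) = c N - 1" using Suc.prems(2)[of N] by auto
  then show ?case
  proof cases
    case 1
    (* The interval grows on the right. *)
    let ?v = "extend_vec (x N) (x (Suc N)) (w ?l) (w ?r)"
    let ?w = "w(?r + 1 := ?v)"
    have "range ?w \<subseteq> S \<times> S" using wS in_S[of ?l ?r] by auto
    moreover have "det2 (?w p) (?w (p + 1)) = 1" if "?l \<le> p" "p < ?r + 1" for p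
      using w1[of p] det2_extend_vec_right(2)[OF d xN(1)] that by (cases "p = ?r") auto
    moreover have "det2 (?w (c k)) (?w (c k + int k + 1)) = x k" if "k \<le> Suc N" for k
    proof (cases "k = Suc N")
      case True
      then show ?thesis using 1 det2_extend_vec_right(1)[OF d xN(1)] by (simp add: algebra_simps)
    next
      case False
      then show ?thesis using nest[of k] wx[of k] that by auto
    qed
    ultimately show ?thesis using 1 by (intro exI[of _ ?w]) (simp add: algebra_simps)
  next
    case 2
    (* The interval grows on the left, so the two end points change roles. *)
    let ?v = "extend_vec (x N) (x (Suc N)) (w ?r) (w ?l)"
    let ?w = "w(?l - 1 := ?v)"
    have "range ?w \<subseteq> S \<times> S" using wS in_S[of ?r ?l] by auto
    moreover have "det2 (?w p) (?w (p + 1)) = 1" if "?l - 1 \<le> p" "p < ?r" for p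
      using w1[of p] det2_extend_vec_left(2)[OF d xN(1)] that by (cases "p = ?l - 1") auto
    moreover have "det2 (?w (c k)) (?w (c k + int k + 1)) = x k" if "k \<le> Suc N" for k
    proof (cases "k = Suc N")
      case True
      then have e: "c k = ?l - 1" "c k + int k + 1 = ?r" using 2 by auto
      have "?w (c k) = ?v" by (subst e(1)) simp
      moreover have "?w (c k + int k + 1) = w ?r" by (subst e(2)) simp
      ultimately show ?thesis using True det2_extend_vec_left(1)[OF d xN(1)] by simp
    next
      case False
      then show ?thesis using nest[of k] wx[of k] that by auto
    qed
    ultimately show ?thesis using 2 by (intro exI[of _ ?w]) (simp add: algebra_simps)
  qed
qed

text \<open>
  The last vector of the block is followed by \<open>- w P\<close>, and the sign is what makes the determinant
  at the seam \<open>det2 (w (P + M - 1)) (- w P) = det2 (w P) (w (P + M - 1)) = 1\<close>.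
\<close>

lemma antiperiodic_extension:
  fixes w :: "int \<Rightarrow> 'a::field \<times> 'a" and P M :: int
  assumes S: "is_subring S" "range w \<subseteq> S \<times> S" and M: "M > 1"
    and one: "\<And>p. P \<le> p \<Longrightarrow> p < P + M - 1 \<Longrightarrow> det2 (w p) (w (p + 1)) = 1"
    and last: "det2 (w P) (w (P + M - 1)) = 1"
  obtains W where "range W \<subseteq> S \<times> S"
    "\<And>p. P \<le> p \<Longrightarrow> p < P + M \<Longrightarrow> W p = w p"
    "\<And>p. det2 (W p) (W (p + 1)) = 1"
    "\<And>p. W (p + M) = (- fst (W p), - snd (W p))"
proof -
  define W where "W p = (let v = w (P + (p - P) mod M) in
      if even ((p - P) div M) then v else (- fst v, - snd v))" for p
  have neg: "- a \<in> S" if "a \<in> S" for a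
    using S(1) that unfolding is_subring_def by (metis diff_0)
  have "W p \<in> S \<times> S" for p
  proof -
    have "w q \<in> S \<times> S" for q using S(2) by auto
    then show ?thesis by (auto simp: W_def Let_def neg mem_Times_iff)
  qed
  moreover have "W p = w p" if "P \<le> p" "p < P + M" for p
    using that by (simp add: W_def)
  moreover have "det2 (W p) (W (p + 1)) = 1" for p
  proof -
    define q r where "q = (p - P) div M" and "r = (p - P) mod M"
    have r: "0 \<le> r" "r < M" using M by (auto simp: r_def)
    have p: "p - P = q * M + r" by (simp add: q_def r_def)
    show ?thesis
    proof (cases "r = M - 1")
      case True
      have "p + 1 - P = (q + 1) * M" using p True by (simp add: algebra_simps)
      then have "(p + 1 - P) div M = q + 1" "(p + 1 - P) mod M = 0" using M by simp_all
      moreover have "det2 (w P) (w (P + r)) = 1" using last by (simp add: True add_diff_eq)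
      ultimately show ?thesis
        by (simp add: W_def Let_def det2_def algebra_simps flip: q_def r_def)
    next
      case False
      have "p + 1 - P = (r + 1) + q * M" using p by simp
      then have "(p + 1 - P) div M = q" "(p + 1 - P) mod M = r + 1" using r False M
        by (simp_all only: div_mult_self1 mod_mult_self1) auto
      then show ?thesis using one[of "P + r"] r False
        by (simp add: W_def Let_def det2_def algebra_simps flip: q_def r_def)
    qed
  qed
  moreover have "W (p + M) = (- fst (W p), - snd (W p))" for p
  proof -
    have "p + M - P = (p - P) + 1 * M" by simp
    then have "(p + M - P) div M = (p - P) div M + 1" "(p + M - P) mod M = (p - P) mod M"
      using M by (simp_all only: div_mult_self1 mod_mult_self1)
    then show ?thesis by (simp add: W_def Let_def)
  qed
  ultimately show ?thesis using that[of W] by blast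
qed

text \<open>
  A frieze in a field can be prescribed along a lightning bolt, and its entries then lie in every
  subring that contains the prescribed entries and their inverses. With the indeterminates as
  prescribed entries this is the Laurent phenomenon for the cluster variables of a frieze.
\<close>

lemma frieze_with_given_bolt:
  fixes x :: "nat \<Rightarrow> 'a::field" and b :: "nat \<Rightarrow> int"
  assumes n: "n \<ge> 1" and b: "lightning_bolt n b" and S: "is_subring S"
    and x: "\<And>k. k \<in> {1..n} \<Longrightarrow> x k \<noteq> 0 \<and> x k \<in> S \<and> inverse (x k) \<in> S"
  obtains F :: "nat \<Rightarrow> int \<Rightarrow> 'a" where
    "\<And>i j. F i j \<in> S" "\<And>j. F 0 j = 1" "\<And>j. F (n + 1) j = 1"
    "\<And>i j. i \<ge> 1 \<Longrightarrow> F i j * F i (j + 1) = 1 + F (i - 1) (j + 1) * F (i + 1) j"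
    "\<And>k. k \<in> {1..n} \<Longrightarrow> F k (b k) = x k"
proof -
  (* The bolt is continued into the two rows of ones, so that its intervals exhaust a block of
     n + 3 consecutive points. *)
  define c where "c = b(0 := b 1, n + 1 := b n)"
  define y where "y k = (if k \<in> {1..n} then x k else 1)" for k
  have y: "y k \<noteq> 0 \<and> y k \<in> S \<and> inverse (y k) \<in> S" for k
    using x[of k] S by (auto simp: y_def is_subring_def)
  have c: "c (Suc k) \<in> {c k, c k - 1}" if "k < n + 1" for k
  proof -
    consider "k = 0" | "k = n" | "k \<in> {1..<n}" using \<open>k < n + 1\<close> by force
    then show ?thesis
      using n b by cases (auto simp: c_def lightning_bolt_def)
  qed
  obtain w :: "int \<Rightarrow> 'a \<times> 'a" where w: "range w \<subseteq> S \<times> S"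
    "\<And>p. c (n + 1) \<le> p \<Longrightarrow> p < c (n + 1) + int (n + 1) + 1 \<Longrightarrow> det2 (w p) (w (p + 1)) = 1"
    "\<And>k. k \<le> n + 1 \<Longrightarrow> det2 (w (c k)) (w (c k + int k + 1)) = y k"
    using snake_vectors[OF S, of y "n + 1" c] y c by (auto simp: y_def)
  define P M where "P = c (n + 1)" and "M = int n + 3"
  obtain W where W: "range W \<subseteq> S \<times> S"
    "\<And>p. P \<le> p \<Longrightarrow> p < P + M \<Longrightarrow> W p = w p"
    "\<And>p. det2 (W p) (W (p + 1)) = 1"
    "\<And>p. W (p + M) = (- fst (W p), - snd (W p))"
    by (rule antiperiodic_extension[OF S w(1), of M P])
      (use w(2) w(3)[of "n + 1"] in \<open>auto simp: P_def M_def y_def algebra_simps\<close>)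
  define F where "F i j = det2 (W j) (W (j + int i + 1))" for i j
  have "F i j \<in> S" for i j
  proof -
    have "W p \<in> S \<times> S" for p using W(1) by auto
    then show ?thesis using S by (simp add: F_def det2_def is_subring_def mem_Times_iff)
  qed
  moreover have "F 0 j = 1" for j using W(3) by (simp add: F_def)
  (* Position j + n + 2 is one period after j - 1. *)
  moreover have "F (n + 1) j = 1" for j
    using W(3)[of "j - 1"] W(4)[of "j - 1"] by (simp add: F_def M_def det2_def algebra_simps)
  moreover have "F i j * F i (j + 1) = 1 + F (i - 1) (j + 1) * F (i + 1) j" if "i \<ge> 1" for i j
  proof -
    have "j + 1 + int (i - 1) + 1 = j + int i + 1" using that by simp
    then show ?thesis
      using det2_plucker[of "W j" "W (j + int i + 1)" "W (j + 1)" "W (j + int i + 1 + 1)"]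
        W(3)[of j] W(3)[of "j + int i + 1"]
      by (simp add: F_def algebra_simps)
  qed
  moreover have "F k (b k) = x k" if "k \<in> {1..n}" for k
  proof -
    have "P \<le> c k \<and> c k + int k \<le> P + int n + 1"
      using bolt_chords_nested[of "n + 1" c k] c that by (auto simp: P_def)
    then have "F k (c k) = y k" using w(3)[of k] W(2) that by (simp add: F_def M_def)
    then show ?thesis using that by (simp add: c_def y_def)
  qed
  ultimately show ?thesis using that[of F] by blast
qed

section \<open>Specialisation\<close>

lemma poly_vars_add: "poly_vars (p + q) \<subseteq> poly_vars p \<union> poly_vars q"
  using Poly_Mapping.keys_add[of p q] by (auto simp: poly_vars_def)

lemma poly_vars_mult: "poly_vars (p * q) \<subseteq> poly_vars p \<union> poly_vars q"
proof
  fix i assume "i \<in> poly_vars (p * q)"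
  then obtain d where "d \<in> Poly_Mapping.keys (p * q)" "i \<in> Poly_Mapping.keys d"
    by (auto simp: poly_vars_def)
  moreover from this(1) obtain d1 d2 where
      "d = d1 + d2" "d1 \<in> Poly_Mapping.keys p" "d2 \<in> Poly_Mapping.keys q"
    using keys_mult[of p q] by blast
  ultimately show "i \<in> poly_vars p \<union> poly_vars q"
    using Poly_Mapping.keys_add[of d1 d2] by (auto simp: poly_vars_def)
qed

lemma poly_vars_single: "poly_vars (Poly_Mapping.single d c) \<subseteq> Poly_Mapping.keys d"
  by (auto simp: poly_vars_def split: if_splits)

lemma single_one_nonzero: "Poly_Mapping.single d (1::rat) \<noteq> 0"
  by (metis lookup_single_eq lookup_zero zero_neq_one)

lemma monom_eval_nonzero:
  assumes "\<forall>k\<in>A. v k \<noteq> 0" "Poly_Mapping.keys d \<subseteq> A"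
  shows "monom_eval v d \<noteq> 0"
  using assms by (auto simp: monom_eval_def)

lemma specialises_const:
  assumes "\<forall>k\<in>{1..n}. v k \<noteq> 0"
  shows "specialises n v (Fract (Poly_Mapping.single 0 q) 1) q"
  unfolding specialises_def using assms poly_vars_single[of 0 q]
  by (intro conjI exI[of _ "Poly_Mapping.single 0 q"] exI[of _ 0])
    (auto simp: poly_eval_single)

lemma specialises_indet:
  assumes "\<forall>k\<in>{1..n}. v k \<noteq> 0" "k \<in> {1..n}"
  shows "specialises n v (indet k) (v k)"
  unfolding specialises_def indet_def using assms poly_vars_single[of "Poly_Mapping.single k 1" 1]
  by (intro conjI exI[of _ "Poly_Mapping.single (Poly_Mapping.single k 1) 1"] exI[of _ 0])
    (auto simp: poly_eval_single monom_eval_def)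

lemma specialises_inverse_indet:
  assumes "\<forall>k\<in>{1..n}. v k \<noteq> 0" "k \<in> {1..n}"
  shows "specialises n v (inverse (indet k)) (inverse (v k))"
  unfolding specialises_def indet_def using assms poly_vars_single[of 0 1]
  by (intro conjI exI[of _ "1 :: polynomial"] exI[of _ "Poly_Mapping.single k 1"])
    (auto simp: monom_eval_def divide_inverse)

lemma specialises_add:
  assumes "specialises n v f a" "specialises n v g c"
  shows "specialises n v (f + g) (a + c)"
proof -
  obtain p d where 1: "poly_vars p \<subseteq> {1..n}" "Poly_Mapping.keys d \<subseteq> {1..n}"
      "f = Fract p (Poly_Mapping.single d 1)" "a = poly_eval v p / monom_eval v d"
    using assms(1) unfolding specialises_def by blast
  obtain q e where 2: "poly_vars q \<subseteq> {1..n}" "Poly_Mapping.keys e \<subseteq> {1..n}"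
      "g = Fract q (Poly_Mapping.single e 1)" "c = poly_eval v q / monom_eval v e"
    using assms(2) unfolding specialises_def by blast
  have v: "\<forall>k\<in>{1..n}. v k \<noteq> 0" using assms(1) by (simp add: specialises_def)
  let ?r = "p * Poly_Mapping.single e 1 + q * Poly_Mapping.single d 1"
  have "poly_vars ?r \<subseteq> {1..n}"
    using poly_vars_add[of "p * Poly_Mapping.single e 1" "q * Poly_Mapping.single d 1"]
      poly_vars_mult[of p "Poly_Mapping.single e 1"] poly_vars_mult[of q "Poly_Mapping.single d 1"]
      poly_vars_single[of d 1] poly_vars_single[of e 1] 1(1,2) 2(1,2) by blast
  moreover have "Poly_Mapping.keys (d + e) \<subseteq> {1..n}"
    using Poly_Mapping.keys_add[of d e] 1(2) 2(2) by blast
  moreover have "f + g = Fract ?r (Poly_Mapping.single (d + e) 1)"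
    unfolding 1(3) 2(3)
    by (subst add_fract) (simp_all add: single_one_nonzero mult_single)
  moreover have "a + c = poly_eval v ?r / monom_eval v (d + e)"
    using 1(4) 2(4) monom_eval_nonzero[OF v 1(2)] monom_eval_nonzero[OF v 2(2)]
    by (simp add: poly_eval_add poly_eval_mult poly_eval_single monom_eval_add add_frac_eq)
  ultimately show ?thesis unfolding specialises_def using v by blast
qed

lemma specialises_mult:
  assumes "specialises n v f a" "specialises n v g c"
  shows "specialises n v (f * g) (a * c)"
proof -
  obtain p d where 1: "poly_vars p \<subseteq> {1..n}" "Poly_Mapping.keys d \<subseteq> {1..n}"
      "f = Fract p (Poly_Mapping.single d 1)" "a = poly_eval v p / monom_eval v d"
    using assms(1) unfolding specialises_def by blast
  obtain q e where 2: "poly_vars q \<subseteq> {1..n}" "Poly_Mapping.keys e \<subseteq> {1..n}"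
      "g = Fract q (Poly_Mapping.single e 1)" "c = poly_eval v q / monom_eval v e"
    using assms(2) unfolding specialises_def by blast
  have v: "\<forall>k\<in>{1..n}. v k \<noteq> 0" using assms(1) by (simp add: specialises_def)
  have "poly_vars (p * q) \<subseteq> {1..n}"
    using poly_vars_mult[of p q] 1(1) 2(1) by blast
  moreover have "Poly_Mapping.keys (d + e) \<subseteq> {1..n}"
    using Poly_Mapping.keys_add[of d e] 1(2) 2(2) by blast
  moreover have "f * g = Fract (p * q) (Poly_Mapping.single (d + e) 1)"
    using 1(3) 2(3) by (simp add: mult_single)
  moreover have "a * c = poly_eval v (p * q) / monom_eval v (d + e)"
    using 1(4) 2(4) by (simp add: poly_eval_mult monom_eval_add)
  ultimately show ?thesis unfolding specialises_def using v by blast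
qed

lemma specialises_0: "\<forall>k\<in>{1..n}. v k \<noteq> 0 \<Longrightarrow> specialises n v 0 0"
  using specialises_const[of n v 0] by (simp add: Zero_fract_def)

lemma specialises_1: "\<forall>k\<in>{1..n}. v k \<noteq> 0 \<Longrightarrow> specialises n v 1 1"
  using specialises_const[of n v 1] by (simp add: One_fract_def)

lemma specialises_diff:
  assumes "specialises n v f a" "specialises n v g c"
  shows "specialises n v (f - g) (a - c)"
proof -
  have v: "\<forall>k\<in>{1..n}. v k \<noteq> 0" using assms(1) by (simp add: specialises_def)
  have "Fract (Poly_Mapping.single 0 (- 1)) 1 = (- 1 :: ratfun)"
    by (simp add: One_fract_def single_uminus)
  then have "specialises n v (- 1) (- 1)" using specialises_const[OF v, of "- 1"] by simp
  from specialises_add[OF assms(1) specialises_mult[OF this assms(2)]] show ?thesis by simp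
qed

text \<open>
  Each rational function that specialises is a Laurent polynomial, so this is the subring in which
  the entries of a frieze of rational functions are to be found.
\<close>

lemma subring_specialisable:
  assumes "\<forall>k\<in>{1..n}. v k \<noteq> 0"
  shows "is_subring {f. \<exists>a. specialises n v f a}"
  unfolding is_subring_def
  using specialises_0[OF assms] specialises_1[OF assms] specialises_diff specialises_mult by blast

lemma indet_nonzero: "indet k \<noteq> 0"
  using positive_at_one_indet positive_at_one_nonzero by blast

section \<open>Moving lightning bolts\<close>

text \<open>
  That both \<open>c\<close> and \<open>c'\<close> are lightning bolts forces the neighbours of \<open>c k\<close> in the bolt to lie to
  its right and those of \<open>c' k\<close> to lie to its left, see lemma \<open>bolt_moveD\<close>.
\<close>

definition bolt_move :: "nat \<Rightarrow> (nat \<Rightarrow> int) \<Rightarrow> (nat \<Rightarrow> int) \<Rightarrow> bool" where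
  "bolt_move n c c' \<longleftrightarrow> lightning_bolt n c \<and> lightning_bolt n c' \<and>
     (\<exists>k\<in>{1..n}. c' = c(k := c k + 1))"

lemma lightning_boltD:
  "lightning_bolt n c \<Longrightarrow> 1 \<le> i \<Longrightarrow> i < n \<Longrightarrow> c (i + 1) = c i \<or> c (i + 1) = c i - 1"
  by (auto simp: lightning_bolt_def)

text \<open>
  Among the entries of \<open>c\<close> that have not yet reached \<open>d\<close>, a leftmost one can be moved. Its neighbours
  in the bolt lie to its right: if a neighbour has not reached \<open>d\<close>, this is because of the choice of the
  leftmost entry, and if it has, then because otherwise the two entries of \<open>d\<close> in these rows would be
  too far apart for the bolt \<open>d\<close>.
\<close>

lemma bolt_moves_connect:
  assumes "lightning_bolt n c" "lightning_bolt n d"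
    and "\<And>k. c k \<le> d k" "\<And>k. k \<notin> {1..n} \<Longrightarrow> c k = d k"
  shows "(bolt_move n)\<^sup>*\<^sup>* c d"
  using assms
proof (induction "\<Sum>k=1..n. nat (d k - c k)" arbitrary: c rule: less_induct)
  case less
  define A where "A = {k\<in>{1..n}. c k < d k}"
  show ?case
  proof (cases "A = {}")
    case True
    have "c k = d k" for k
      using less.prems(3,4)[of k] True by (cases "k \<in> {1..n}") (force simp: A_def)+
    then have "c = d" by blast
    then show ?thesis by simp
  next
    case False
    (* 2 * c k + k is the horizontal position of the entry. *)
    define k where "k = arg_min_on (\<lambda>k. 2 * c k + int k) A"
    have A: "finite A" by (simp add: A_def)
    have kA: "k \<in> A" unfolding k_def using A False by (rule arg_min_if_finite)
    have min: "2 * c k + int k \<le> 2 * c l + int l" if "l \<in> A" for l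
      unfolding k_def by (rule arg_min_least[OF A False that])
    have k: "k \<in> {1..n}" "c k < d k" using kA by (auto simp: A_def)
    have left: "c k = c i - 1" if "1 \<le> i" "k = i + 1" for i
    proof (rule ccontr)
      assume "c k \<noteq> c i - 1"
      then have "c k = c i" using lightning_boltD[OF less.prems(1), of i] that k by auto
      moreover have "i \<notin> A" using min[of i] that calculation by auto
      ultimately have "d i = c k" using less.prems(3)[of i] that k by (auto simp: A_def)
      then show False using lightning_boltD[OF less.prems(2), of i] that k by auto
    qed
    have right: "c (k + 1) = c k" if "k < n"
    proof (rule ccontr)
      assume "c (k + 1) \<noteq> c k"
      then have eq: "c (k + 1) = c k - 1"
        using lightning_boltD[OF less.prems(1), of k] that k by auto
      moreover have "k + 1 \<notin> A" using min[of "k + 1"] that calculation by auto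
      ultimately have "d (k + 1) = c k - 1"
        using less.prems(3)[of "k + 1"] that k by (auto simp: A_def)
      then show False using lightning_boltD[OF less.prems(2), of k] that k by auto
    qed
    define c' where "c' = c(k := c k + 1)"
    have bolt': "lightning_bolt n c'"
      unfolding lightning_bolt_def
    proof
      fix i assume i: "i \<in> {1..<n}"
      consider "i = k" | "i + 1 = k" | "i \<noteq> k" "i + 1 \<noteq> k" by blast
      then show "c' (i + 1) \<in> {c' i, c' i - 1}"
      proof cases
        case 1
        then have "c' i = c k + 1" "c' (i + 1) = c k" using right i by (auto simp: c'_def)
        then show ?thesis by simp
      next
        case 2
        then have "c' i = c i" "c' (i + 1) = c k + 1" by (auto simp: c'_def)
        then show ?thesis using left[of i] i 2 by simp
      next
        case 3
        then have "c' i = c i" "c' (i + 1) = c (i + 1)" by (auto simp: c'_def)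
        then show ?thesis using lightning_boltD[OF less.prems(1), of i] i by simp
      qed
    qed
    have "(\<Sum>l=1..n. nat (d l - c' l)) < (\<Sum>l=1..n. nat (d l - c l))"
      using k by (intro sum_strict_mono_ex1) (auto simp: c'_def)
    moreover have "c' l \<le> d l" for l using less.prems(3)[of l] k by (auto simp: c'_def)
    moreover have "c' l = d l" if "l \<notin> {1..n}" for l
      using less.prems(4)[of l] k that by (auto simp: c'_def)
    ultimately have "(bolt_move n)\<^sup>*\<^sup>* c' d"
      using less.hyps bolt' less.prems(2) by blast
    moreover have "bolt_move n c c'"
      unfolding bolt_move_def using less.prems(1) bolt' k(1) c'_def by blast
    ultimately show ?thesis by (metis converse_rtranclp_into_rtranclp)
  qed
qed

section \<open>The quiver of a lightning bolt\<close>

text \<open>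
  Arrows point from left to right: the entry of row \<open>i + 1\<close> lies to the right of the entry of row
  \<open>i\<close> if \<open>c (i + 1) = c i\<close>, and to its left if \<open>c (i + 1) = c i - 1\<close>.
\<close>

definition bolt_arrow :: "(nat \<Rightarrow> int) \<Rightarrow> nat \<Rightarrow> nat \<times> nat" where
  "bolt_arrow c i = (if c (i + 1) = c i then (i, i + 1) else (i + 1, i))"

definition bolt_quiver :: "nat \<Rightarrow> (nat \<Rightarrow> int) \<Rightarrow> quiver" where
  "bolt_quiver n c = image_mset (bolt_arrow c) (mset_set {1..<n})"

lemma bolt_quiver_orientation: "A_orientation n (bolt_quiver n c)"
proof -
  have "count (bolt_quiver n c) (i, i + 1) + count (bolt_quiver n c) (i + 1, i) = 1"
    if i: "i \<in> {1..<n}" for i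
  proof -
    have "count (bolt_quiver n c) a = (if a = bolt_arrow c i then 1 else 0)"
      if "a = (i, i + 1) \<or> a = (i + 1, i)" for a
    proof -
      have "bolt_arrow c -` {a} \<inter> {1..<n} = (if a = bolt_arrow c i then {i} else {})"
        using that i by (auto simp: bolt_arrow_def split: if_splits)
      then show ?thesis using i by (simp add: bolt_quiver_def count_image_mset)
    qed
    then show ?thesis by (auto simp: bolt_arrow_def)
  qed
  then show ?thesis
    by (auto simp: A_orientation_def quiver_def bolt_quiver_def bolt_arrow_def split: if_splits)
qed

lemma prod_filtered_bolt_quiver:
  fixes g :: "nat \<times> nat \<Rightarrow> 'a::comm_monoid_mult"
  shows "(\<Prod>a\<in>#{#a \<in># bolt_quiver n c. P a#}. g a) =
    (\<Prod>i\<in>{i\<in>{1..<n}. P (bolt_arrow c i)}. g (bolt_arrow c i))"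
  by (simp add: bolt_quiver_def filter_mset_image_mset filter_mset_mset_set image_mset.compositionality
      comp_def prod_unfold_prod_mset)

lemma cancel_2cycles_cluster_quiver:
  assumes "cluster_quiver n Q" shows "cancel_2cycles Q = Q"
proof (rule multiset_eqI)
  fix a :: "nat \<times> nat"
  obtain i j where a: "a = (i, j)" by (cases a)
  have "count Q (i, j) = 0 \<or> count Q (j, i) = 0"
    using assms by (auto simp: cluster_quiver_def count_eq_zero_iff)
  then show "count (cancel_2cycles Q) a = count Q a"
    by (auto simp: a count_cancel_2cycles)
qed

lemma add_composites_source_or_sink:
  assumes "{#a \<in># Q. snd a = k#} = {#} \<or> {#a \<in># Q. fst a = k#} = {#}"
  shows "add_composites k Q = Q"
  using assms by (auto simp: add_composites_def)

text \<open>
  At a source or sink there are no paths of length two through \<open>k\<close>. So mutation reverses the arrows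
  at \<open>k\<close> and does nothing else, the result being again an orientation, without 2-cycles.
\<close>

lemma mutate_bolt_quiver:
  assumes rev: "\<And>i. i \<in> {1..<n} \<Longrightarrow> bolt_arrow c' i =
      (if i = k \<or> i + 1 = k then prod.swap (bolt_arrow c i) else bolt_arrow c i)"
    and "{#a \<in># bolt_quiver n c. snd a = k#} = {#} \<or> {#a \<in># bolt_quiver n c. fst a = k#} = {#}"
  shows "mutate_quiver k (bolt_quiver n c) = bolt_quiver n c'"
proof -
  have "reverse_at k (bolt_quiver n c) = bolt_quiver n c'"
    unfolding reverse_at_def bolt_quiver_def multiset.map_comp
  proof (rule image_mset_cong)
    fix i assume "i \<in># mset_set {1..<n}"
    then have i: "i \<in> {1..<n}" by simp
    obtain x y where xy: "bolt_arrow c i = (x, y)" by (cases "bolt_arrow c i")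
    then have "x = k \<or> y = k \<longleftrightarrow> i = k \<or> i + 1 = k"
      by (cases "c (i + 1) = c i") (auto simp: bolt_arrow_def)
    then show "((\<lambda>(i, j). if i = k \<or> j = k then (j, i) else (i, j)) \<circ> bolt_arrow c) i = bolt_arrow c' i"
      using rev[OF i] xy by simp
  qed
  then show ?thesis
    using assms(2) cancel_2cycles_cluster_quiver[OF cluster_quiver_orientation[OF bolt_quiver_orientation]]
    by (simp add: mutate_quiver_def add_composites_source_or_sink)
qed

lemma bolt_moveD:
  assumes "bolt_move n c c'"
  obtains k where "k \<in> {1..n}" "c' = c(k := c k + 1)"
    "k < n \<Longrightarrow> c (k + 1) = c k" "1 < k \<Longrightarrow> c (k - 1) = c k + 1"
proof -
  obtain k where k: "k \<in> {1..n}" "c' = c(k := c k + 1)"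
    and b: "lightning_bolt n c" "lightning_bolt n c'"
    using assms by (auto simp: bolt_move_def)
  have "c (k + 1) = c k" if "k < n"
    using lightning_boltD[OF b(1), of k] lightning_boltD[OF b(2), of k] k that by auto
  moreover have "c (k - 1) = c k + 1" if "1 < k"
  proof -
    have "k - 1 \<noteq> k" "k - 1 + 1 = k" "1 \<le> k - 1" "k - 1 < n" using that k by auto
    then show ?thesis
      using lightning_boltD[OF b(1), of "k - 1"] lightning_boltD[OF b(2), of "k - 1"] k by auto
  qed
  ultimately show ?thesis using that k by blast
qed

definition neighbour_product :: "nat \<Rightarrow> (nat \<Rightarrow> 'a::comm_monoid_mult) \<Rightarrow> nat \<Rightarrow> 'a" where
  "neighbour_product n f k = (if 1 < k then f (k - 1) else 1) * (if k < n then f (k + 1) else 1)"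

text \<open>
  The edge \<open>i\<close> joins \<open>i\<close> and \<open>i + 1\<close>, so \<open>k\<close> is an end of the edges \<open>k\<close> and \<open>k - 1\<close>, and
  \<open>if i = k then k + 1 else i\<close> is the other end.
\<close>

lemma prod_edges_at:
  fixes f :: "nat \<Rightarrow> 'a::comm_monoid_mult"
  assumes "k \<in> {1..n}"
  shows "(\<Prod>i\<in>{i\<in>{1..<n}. i = k \<or> i + 1 = k}. f (if i = k then k + 1 else i)) =
    neighbour_product n f k"
proof -
  have edges: "{i\<in>{1..<n}. i = k \<or> i + 1 = k} = (if 1 < k then {k - 1} else {}) \<union> (if k < n then {k} else {})"
    using assms by auto
  obtain l where "k = Suc l" using assms by (cases k) auto
  then show ?thesis unfolding edges
    by (cases "1 < k"; cases "k < n") (simp_all add: neighbour_product_def mult.commute)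
qed

lemma bolt_quiver_source:
  fixes f :: "nat \<Rightarrow> 'a::comm_monoid_mult"
  assumes k: "k \<in> {1..n}" and "k < n \<Longrightarrow> c (k + 1) = c k" "1 < k \<Longrightarrow> c (k - 1) = c k + 1"
  shows "{#a \<in># bolt_quiver n c. snd a = k#} = {#}"
    "(\<Prod>a\<in>#{#a \<in># bolt_quiver n c. fst a = k#}. f (snd a)) = neighbour_product n f k"
proof -
  have arrow: "bolt_arrow c i = (k, if i = k then k + 1 else i)"
    if "i \<in> {1..<n}" "i = k \<or> i + 1 = k" for i
    using assms that by (auto simp: bolt_arrow_def)
  have ends: "fst (bolt_arrow c i) = k \<longleftrightarrow> i = k \<or> i + 1 = k" "snd (bolt_arrow c i) \<noteq> k"
    if "i \<in> {1..<n}" for i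
    using arrow[OF that] by (cases "i = k \<or> i + 1 = k"; auto simp: bolt_arrow_def)+
  show "{#a \<in># bolt_quiver n c. snd a = k#} = {#}"
    using ends(2) by (auto simp: bolt_quiver_def filter_mset_eq_conv)
  have "(\<Prod>a\<in>#{#a \<in># bolt_quiver n c. fst a = k#}. f (snd a)) =
      (\<Prod>i\<in>{i\<in>{1..<n}. i = k \<or> i + 1 = k}. f (if i = k then k + 1 else i))"
    unfolding prod_filtered_bolt_quiver using ends(1) arrow by (intro prod.cong) auto
  then show "(\<Prod>a\<in>#{#a \<in># bolt_quiver n c. fst a = k#}. f (snd a)) = neighbour_product n f k"
    by (simp only: prod_edges_at[OF k])
qed

lemma bolt_quiver_sink:
  fixes f :: "nat \<Rightarrow> 'a::comm_monoid_mult"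
  assumes k: "k \<in> {1..n}" and "k < n \<Longrightarrow> c (k + 1) = c k - 1" "1 < k \<Longrightarrow> c (k - 1) = c k"
  shows "{#a \<in># bolt_quiver n c. fst a = k#} = {#}"
    "(\<Prod>a\<in>#{#a \<in># bolt_quiver n c. snd a = k#}. f (fst a)) = neighbour_product n f k"
proof -
  have arrow: "bolt_arrow c i = (if i = k then k + 1 else i, k)"
    if "i \<in> {1..<n}" "i = k \<or> i + 1 = k" for i
    using assms that by (auto simp: bolt_arrow_def)
  have ends: "snd (bolt_arrow c i) = k \<longleftrightarrow> i = k \<or> i + 1 = k" "fst (bolt_arrow c i) \<noteq> k"
    if "i \<in> {1..<n}" for i
    using arrow[OF that] by (cases "i = k \<or> i + 1 = k"; auto simp: bolt_arrow_def)+
  show "{#a \<in># bolt_quiver n c. fst a = k#} = {#}"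
    using ends(2) by (auto simp: bolt_quiver_def filter_mset_eq_conv)
  have "(\<Prod>a\<in>#{#a \<in># bolt_quiver n c. snd a = k#}. f (fst a)) =
      (\<Prod>i\<in>{i\<in>{1..<n}. i = k \<or> i + 1 = k}. f (if i = k then k + 1 else i))"
    unfolding prod_filtered_bolt_quiver using ends(1) arrow by (intro prod.cong) auto
  then show "(\<Prod>a\<in>#{#a \<in># bolt_quiver n c. snd a = k#}. f (fst a)) = neighbour_product n f k"
    by (simp only: prod_edges_at[OF k])
qed

text \<open>
  The moved entry is a source of the quiver before the move and a sink after it, and in both cases
  one of the two products in the exchange relation is empty. Hence the same formula describes the
  move and its inverse.
\<close>

lemma mutate_seed_bolt_move:
  assumes "k \<in> {1..n}" "k < n \<Longrightarrow> c (k + 1) = c k" "1 < k \<Longrightarrow> c (k - 1) = c k + 1"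
    and c': "c' = c(k := c k + 1)"
  shows "mutate_seed k (bolt_quiver n c, f) =
      (bolt_quiver n c', f(k := (1 + neighbour_product n f k) / f k))"
    and "mutate_seed k (bolt_quiver n c', f) =
      (bolt_quiver n c, f(k := (1 + neighbour_product n f k) / f k))"
proof -
  have source: "{#a \<in># bolt_quiver n c. snd a = k#} = {#}"
    "(\<Prod>a\<in>#{#a \<in># bolt_quiver n c. fst a = k#}. f (snd a)) = neighbour_product n f k"
    by (rule bolt_quiver_source; use assms(1-3) in blast)+
  have peak: "k < n \<Longrightarrow> c' (k + 1) = c' k - 1" "1 < k \<Longrightarrow> c' (k - 1) = c' k"
    using assms(2,3) by (auto simp: c')
  have sink: "{#a \<in># bolt_quiver n c'. fst a = k#} = {#}"
    "(\<Prod>a\<in>#{#a \<in># bolt_quiver n c'. snd a = k#}. f (fst a)) = neighbour_product n f k"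
    by (rule bolt_quiver_sink; use assms(1) peak in blast)+
  have rev: "bolt_arrow c' i = (if i = k \<or> i + 1 = k then prod.swap (bolt_arrow c i) else bolt_arrow c i)"
    "bolt_arrow c i = (if i = k \<or> i + 1 = k then prod.swap (bolt_arrow c' i) else bolt_arrow c' i)"
    if i: "i \<in> {1..<n}" for i
  proof -
    have "bolt_arrow c' i = (if i = k \<or> i + 1 = k then prod.swap (bolt_arrow c i) else bolt_arrow c i)"
    proof -
      consider "i = k" | "i + 1 = k" | "i \<noteq> k" "i + 1 \<noteq> k" by blast
      then show ?thesis
      proof cases
        case 1
        then have "c (i + 1) = c i" using assms(2) i by simp
        then show ?thesis using 1 by (simp add: bolt_arrow_def c')
      next
        case 2
        then have "c i = c (i + 1) + 1" using assms(3) i by auto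
        then show ?thesis using 2 by (auto simp: bolt_arrow_def c')
      qed (simp add: bolt_arrow_def c')
    qed
    then show "bolt_arrow c' i = (if i = k \<or> i + 1 = k then prod.swap (bolt_arrow c i) else bolt_arrow c i)"
      "bolt_arrow c i = (if i = k \<or> i + 1 = k then prod.swap (bolt_arrow c' i) else bolt_arrow c' i)"
      by auto
  qed
  have mut: "mutate_quiver k (bolt_quiver n c) = bolt_quiver n c'"
    "mutate_quiver k (bolt_quiver n c') = bolt_quiver n c"
    using mutate_bolt_quiver[of n c' k c] mutate_bolt_quiver[of n c k c'] rev source(1) sink(1)
    by blast+
  show "mutate_seed k (bolt_quiver n c, f) =
      (bolt_quiver n c', f(k := (1 + neighbour_product n f k) / f k))"
    unfolding mutate_seed_def prod.case mut(1) source
    by (simp add: add.commute)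
  show "mutate_seed k (bolt_quiver n c', f) =
      (bolt_quiver n c, f(k := (1 + neighbour_product n f k) / f k))"
    unfolding mutate_seed_def prod.case mut(2) sink
    by simp
qed

section \<open>Every lightning bolt is a cluster\<close>

text \<open>
  A value of \<open>h\<close> is known to exist; since specialisation respects sums and products, the two exchange
  relations leave only \<open>q\<close> for it. The value \<open>p \<noteq> 0\<close> also shows that \<open>g \<noteq> 0\<close>.
\<close>

lemma specialises_exchange:
  assumes "g * h = 1 + B" "p * q = 1 + \<mu>" "p \<noteq> 0"
    and "specialises n v g p" "specialises n v B \<mu>" "specialises n v h d"
  shows "h = (1 + B) / g" "specialises n v h q"
proof -
  have v: "\<forall>k\<in>{1..n}. v k \<noteq> 0" using assms(4) by (simp add: specialises_def)
  have "g \<noteq> 0" using assms(3,4) specialises_unique[OF _ specialises_0[OF v]] by blast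
  then show "h = (1 + B) / g" using assms(1) by (simp add: field_simps)
  have "specialises n v (1 + B) (1 + \<mu>)" by (rule specialises_add[OF specialises_1[OF v] assms(5)])
  then have "p * d = p * q"
    using specialises_unique specialises_mult[OF assms(4,6)] assms(1,2) by metis
  then show "specialises n v h q" using assms(3,6) by simp
qed

text \<open>
  The entries of \<open>F\<close> in the bolt \<open>c\<close> form a cluster of \<open>Q\<close> and specialise to the entries of \<open>m\<close>.
  Outside \<open>{1..n}\<close> the values of \<open>f\<close> are those of the initial seed and belong to no entry of \<open>F\<close>.
\<close>

definition realised_bolt ::
    "nat \<Rightarrow> quiver \<Rightarrow> (nat \<Rightarrow> rat) \<Rightarrow> (nat \<Rightarrow> int \<Rightarrow> ratfun) \<Rightarrow> (nat \<Rightarrow> int \<Rightarrow> int) \<Rightarrow>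
     (nat \<Rightarrow> int) \<Rightarrow> bool" where
  "realised_bolt n Q v F m c \<longleftrightarrow> (\<exists>f. (bolt_quiver n c, f) \<in> seeds n Q \<and>
     (\<forall>k\<in>{1..n}. f k = F k (c k) \<and> specialises n v (F k (c k)) (of_int (m k (c k)))))"

text \<open>
  In both directions the new entry and the old one form the left and right corners of one diamond.
  In \<open>F\<close> this diamond is the exchange relation of the mutation at \<open>k\<close>, and in \<open>m\<close> it determines the
  value of the new entry. That \<open>F\<close> has Laurent polynomials as entries ensures that the new
  entry has a value at all.
\<close>

lemma realised_bolt_move:
  assumes m: "frieze_pattern n m"
    and F: "\<And>j. F 0 j = 1" "\<And>j. F (n + 1) j = 1"
      "\<And>i j. i \<ge> 1 \<Longrightarrow> F i j * F i (j + 1) = 1 + F (i - 1) (j + 1) * F (i + 1) j"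
    and laurent: "\<And>i j. \<exists>d. specialises n v (F i j) d"
    and "bolt_move n c c'"
  shows "realised_bolt n Q v F m c \<longleftrightarrow> realised_bolt n Q v F m c'"
proof -
  obtain k where k: "k \<in> {1..n}" and c': "c' = c(k := c k + 1)"
    and right: "k < n \<Longrightarrow> c (k + 1) = c k" and left: "1 < k \<Longrightarrow> c (k - 1) = c k + 1"
    using bolt_moveD[OF assms(6)] by blast
  define j where "j = c k"
  have v: "\<forall>k\<in>{1..n}. v k \<noteq> 0" using laurent by (auto simp: specialises_def)
  have exchange: "realised_bolt n Q v F m e'"
    if e: "realised_bolt n Q v F m e" and e': "e' = e(k := q)"
      and eq: "e k = j \<and> q = j + 1 \<or> e k = j + 1 \<and> q = j"
      and off: "\<And>i. i \<noteq> k \<Longrightarrow> e i = c i"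
      and mut: "\<And>f. mutate_seed k (bolt_quiver n e, f) =
        (bolt_quiver n e', f(k := (1 + neighbour_product n f k) / f k))" for e e' q
  proof -
    obtain f where f: "(bolt_quiver n e, f) \<in> seeds n Q"
      and fF: "\<And>i. i \<in> {1..n} \<Longrightarrow> f i = F i (e i)"
      and sp: "\<And>i. i \<in> {1..n} \<Longrightarrow> specialises n v (F i (e i)) (of_int (m i (e i)))"
      using e by (auto simp: realised_bolt_def)
    let ?B = "F (k - 1) (j + 1) * F (k + 1) j"
    let ?mu = "of_int (m (k - 1) (j + 1)) * of_int (m (k + 1) j) :: rat"
    (* For k = 1 and for k = n, one of the neighbours is an entry of a row of ones. *)
    have up: "specialises n v (F (k - 1) (j + 1)) (of_int (m (k - 1) (j + 1))) \<and>
        (if 1 < k then f (k - 1) else 1) = F (k - 1) (j + 1)"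
    proof (cases "1 < k")
      case True
      then have "k - 1 \<in> {1..n}" "e (k - 1) = j + 1" using k left off[of "k - 1"] by (auto simp: j_def)
      then show ?thesis using True fF[of "k - 1"] sp[of "k - 1"] by simp
    next
      case False
      then have "k - 1 = 0" using k by auto
      then show ?thesis using False F(1) specialises_1[OF v] m by (simp add: frieze_pattern_def)
    qed
    have down: "specialises n v (F (k + 1) j) (of_int (m (k + 1) j)) \<and>
        (if k < n then f (k + 1) else 1) = F (k + 1) j"
    proof (cases "k < n")
      case True
      then have "k + 1 \<in> {1..n}" "e (k + 1) = j" using k right off[of "k + 1"] by (auto simp: j_def)
      then show ?thesis using True fF[of "k + 1"] sp[of "k + 1"] by simp
    next
      case False
      then have "k = n" using k by auto
      then show ?thesis using F(2)[of j] specialises_1[OF v] m by (simp add: frieze_pattern_def)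
    qed
    have nb: "neighbour_product n f k = ?B" using up down by (simp add: neighbour_product_def)
    have "m k j * m k (j + 1) - m (k - 1) (j + 1) * m (k + 1) j = 1"
      using m k by (simp add: frieze_pattern_def)
    then have "m k j * m k (j + 1) = 1 + m (k - 1) (j + 1) * m (k + 1) j" by simp
    from arg_cong[OF this, of rat_of_int]
    have pq: "of_int (m k (e k)) * of_int (m k q) = 1 + ?mu" using eq by (auto simp: mult.commute)
    have FF: "F k (e k) * F k q = 1 + ?B" using eq F(3)[of k j] k by (auto simp: mult.commute)
    have "m k (e k) > 0" using m k by (simp add: frieze_pattern_def)
    then have pos: "rat_of_int (m k (e k)) \<noteq> 0" by simp
    obtain d where d: "specialises n v (F k q) d" using laurent by blast
    have mu: "specialises n v ?B ?mu" using specialises_mult up down by blast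
    note ex = specialises_exchange[OF FF pq pos sp[OF k] mu d]
    have "mutate_seed k (bolt_quiver n e, f) \<in> seeds n Q" using f k by (rule seeds.mutate)
    then show ?thesis
      unfolding mut realised_bolt_def using fF sp ex k
      by (intro exI[of _ "f(k := (1 + neighbour_product n f k) / f k)"]) (auto simp: e' nb)
  qed
  note mut = mutate_seed_bolt_move[OF k right left c']
  show ?thesis
  proof
    assume "realised_bolt n Q v F m c"
    then show "realised_bolt n Q v F m c'"
    proof (rule exchange[where q = "j + 1"])
      show "c' = c(k := j + 1)" by (simp add: c' j_def)
    qed (simp_all add: mut(1) j_def)
  next
    assume "realised_bolt n Q v F m c'"
    then show "realised_bolt n Q v F m c"
    proof (rule exchange[where q = j])
      show "c = c'(k := j)" by (simp add: c' j_def)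
    qed (use mut(2) in \<open>simp_all add: c' j_def\<close>)
  qed
qed

theorem theorem3p9:
  fixes n :: nat and m :: "nat \<Rightarrow> int \<Rightarrow> int" and b :: "nat \<Rightarrow> int"
  assumes "n \<ge> 1"
    and "frieze_pattern n m"
    and "lightning_bolt n b"
  shows "\<exists>Q. A_orientation n Q \<and>
           (\<forall>i\<in>{1..n}. \<forall>j. \<exists>f\<in>cluster_variables n Q.
              specialises n (\<lambda>k. of_int (m k (b k))) f (of_int (m i j)))"
proof -
  define v :: "nat \<Rightarrow> rat" where "v k = of_int (m k (b k))" for k
  have v: "\<forall>k\<in>{1..n}. v k \<noteq> 0"
  proof
    fix k assume "k \<in> {1..n}"
    then have "m k (b k) > 0" using assms(2) by (simp add: frieze_pattern_def)
    then show "v k \<noteq> 0" by (simp add: v_def)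
  qed
  obtain F where laurent: "\<And>i j. F i j \<in> {f. \<exists>a. specialises n v f a}"
    and F: "\<And>j. F 0 j = 1" "\<And>j. F (n + 1) j = 1"
      "\<And>i j. i \<ge> 1 \<Longrightarrow> F i j * F i (j + 1) = 1 + F (i - 1) (j + 1) * F (i + 1) j"
    and bolt: "\<And>k. k \<in> {1..n} \<Longrightarrow> F k (b k) = indet k"
    by (rule frieze_with_given_bolt[OF assms(1,3) subring_specialisable[OF v], of indet])
      (use specialises_indet[OF v] specialises_inverse_indet[OF v] indet_nonzero in blast)+
  define Q where "Q = bolt_quiver n b"
  have start: "realised_bolt n Q v F m b"
    unfolding realised_bolt_def Q_def using bolt specialises_indet[OF v]
    by (intro exI[of _ indet]) (auto simp: seeds.initial simp flip: v_def)
  have move: "realised_bolt n Q v F m c \<longleftrightarrow> realised_bolt n Q v F m c'" if "bolt_move n c c'" for c c'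
  proof (rule realised_bolt_move[OF assms(2) _ _ _ _ that])
    show "\<exists>d. specialises n v (F i j) d" for i j using laurent by blast
  qed (fact F)+
  have moves: "realised_bolt n Q v F m c \<longleftrightarrow> realised_bolt n Q v F m c'"
    if "(bolt_move n)\<^sup>*\<^sup>* c c'" for c c'
    using that by induction (simp_all add: move)
  have "\<exists>f\<in>cluster_variables n Q. specialises n v f (of_int (m i j))" if i: "i \<in> {1..n}" for i j
  proof -
    (* The translate of the bolt that passes through the given entry. *)
    define c where "c k = (if k \<in> {1..n} then b k + (j - b i) else b k)" for k
    have c: "lightning_bolt n c" "c i = j"
      using assms(3) i by (auto simp: lightning_bolt_def c_def)
    have "(bolt_move n)\<^sup>*\<^sup>* b c \<or> (bolt_move n)\<^sup>*\<^sup>* c b"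
    proof (cases "b i \<le> j")
      case True
      then have "b k \<le> c k" "k \<notin> {1..n} \<Longrightarrow> b k = c k" for k by (auto simp: c_def)
      then show ?thesis using bolt_moves_connect[OF assms(3) c(1)] by blast
    next
      case False
      then have "c k \<le> b k" "k \<notin> {1..n} \<Longrightarrow> c k = b k" for k by (auto simp: c_def)
      then show ?thesis using bolt_moves_connect[OF c(1) assms(3)] by blast
    qed
    then have "realised_bolt n Q v F m c" using moves start by blast
    then obtain f where f: "(bolt_quiver n c, f) \<in> seeds n Q" "f i = F i j"
        "specialises n v (F i j) (of_int (m i j))"
      using i c(2) by (auto simp: realised_bolt_def)
    have "F i j \<in> f ` {1..n}" using f(2) i by (metis imageI)
    then have "F i j \<in> cluster_variables n Q"
      using f(1) by (auto simp: cluster_variables_def)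
    then show ?thesis using f(3) by blast
  qed
  moreover have "A_orientation n Q" by (simp add: Q_def bolt_quiver_orientation)
  ultimately show ?thesis unfolding v_def by blast
qed

end
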